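(* Let $\mathcal H$ be a complex Hilbert space, let $T\in\mathcal B(\mathcal H)$ and let $m\ge1$ be an integer. Then $T$ is similar to an $m$-partial isometry whose adjoint is also an $m$-partial isometry if and only if there exists an equivalent Hilbertian norm $|\!|\!|\cdot|\!|\!|$ on $\mathcal H$ such that, if $T^\sharp$ denotes the adjoint of $T$ with respect to the inner product associated with this norm, then $$T\,\Delta^m_{T^\sharp,T}(I)=0\qquad\text{and}\qquad T^\sharp\,\Delta^m_{T,T^\sharp}(I)=0.$$ If $m$ is odd, then (for such a norm) $T$ and $T^\sharp$ are $m$-concave with respect to $|\!|\!|\cdot|\!|\!|$; that is, for all $x\in\mathcal H$, $$\sum_{k=0}^m(-1)^{m-k}\binom mk|\!|\!|T^kx|\!|\!|^2\le0\quad\text{and}\quad\sum_{k=0}^m(-1)^{m-k}\binom mk|\!|\!|(T^\sharp)^kx|\!|\!|^2\le0.$$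
   Context: $\mathcal B(\mathcal H)$ denotes the bounded linear operators on $\mathcal H$ and $I$ the identity. For $V\in\mathcal B(\mathcal H)$ and an integer $m\ge1$, let $\beta_m(V)=\sum_{k=0}^m(-1)^{m-k}\binom mk V^{*k}V^k$; $V$ is an $m$-partial isometry if $V\beta_m(V)=0$. Two operators $A,B\in\mathcal B(\mathcal H)$ are similar if $A=X^{-1}BX$ for some invertible $X\in\mathcal B(\mathcal H)$. An equivalent Hilbertian norm on $\mathcal H$ is a norm induced by an inner product on $\mathcal H$ and equivalent to the original norm. For $A,B\in\mathcal B(\mathcal H)$, $\Delta^m_{A,B}(I)=\sum_{k=0}^m(-1)^k\binom mk A^{m-k}B^{m-k}$. *)

theory Defs
  imports "HOL-Analysis.Analysis"
begin

class complex_vector = real_vector +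
  fixes scaleC :: "complex \<Rightarrow> 'a \<Rightarrow> 'a"  (infixr "*\<^sub>C" 75)
  assumes scaleC_add_right: "c *\<^sub>C (x + y) = c *\<^sub>C x + c *\<^sub>C y"
    and scaleC_add_left: "(c + d) *\<^sub>C x = c *\<^sub>C x + d *\<^sub>C x"
    and scaleC_scaleC: "c *\<^sub>C (d *\<^sub>C x) = (c * d) *\<^sub>C x"
    and scaleC_one: "1 *\<^sub>C x = x"
    and scaleR_scaleC: "r *\<^sub>R x = complex_of_real r *\<^sub>C x"

text \<open>Inner products are linear in the first argument and conjugate-linear in the second.\<close>

definition (in complex_vector) complex_inner_product :: "('a \<Rightarrow> 'a \<Rightarrow> complex) \<Rightarrow> bool" where
  "complex_inner_product ip \<longleftrightarrow>
     (\<forall>x y z. ip (x + y) z = ip x z + ip y z) \<and>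
     (\<forall>c x y. ip (c *\<^sub>C x) y = c * ip x y) \<and>
     (\<forall>x y. ip y x = cnj (ip x y)) \<and>
     (\<forall>x. x \<noteq> 0 \<longrightarrow> Re (ip x x) > 0)"

text \<open>
  By conjugate symmetry \<open>ip x x\<close> is real, so \<open>Re\<close> discards nothing here and above.
\<close>

definition induced_norm :: "('a \<Rightarrow> 'a \<Rightarrow> complex) \<Rightarrow> 'a \<Rightarrow> real" where
  "induced_norm ip x = sqrt (Re (ip x x))"

class chilbert_space = complex_vector + banach +
  fixes cinner :: "'a \<Rightarrow> 'a \<Rightarrow> complex"
  assumes cinner_inner_product: "complex_inner_product cinner"
    and norm_eq_induced_norm: "norm x = induced_norm cinner x"

instantiation complex :: complex_vector
begin

definition scaleC_complex :: "complex \<Rightarrow> complex \<Rightarrow> complex" where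
  "scaleC_complex c x = c * x"

instance
  by standard (auto simp: scaleC_complex_def algebra_simps scaleR_conv_of_real)

end

instantiation complex :: chilbert_space
begin

definition cinner_complex :: "complex \<Rightarrow> complex \<Rightarrow> complex" where
  "cinner_complex x y = x * cnj y"

instance
proof
  show "complex_inner_product (cinner :: complex \<Rightarrow> complex \<Rightarrow> complex)"
    unfolding complex_inner_product_def cinner_complex_def scaleC_complex_def
    by (auto simp: algebra_simps complex_neq_0 simp flip: power2_eq_square)
qed (simp add: induced_norm_def cinner_complex_def cmod_def power2_eq_square)

end

text \<open>\<open>bounded_clinear T\<close> says that \<open>T\<close> is an element of \<open>\<B>(\<H>)\<close>.\<close>

definition bounded_clinear :: "('a::chilbert_space \<Rightarrow> 'a) \<Rightarrow> bool" where
  "bounded_clinear T \<longleftrightarrow> bounded_linear T \<and> (\<forall>c x. T (c *\<^sub>C x) = c *\<^sub>C T x)"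

text \<open>
  The adjoint with respect to an arbitrary inner product. It is unique by definiteness, and for
  an inner product inducing a norm equivalent to the norm of the Hilbert space and a bounded
  operator \<open>A\<close> it exists and is bounded, by the Riesz representation theorem.
\<close>

definition adjoint_wrt :: "('a \<Rightarrow> 'a \<Rightarrow> complex) \<Rightarrow> ('a \<Rightarrow> 'a) \<Rightarrow> 'a \<Rightarrow> 'a" where
  "adjoint_wrt ip A = (THE B. \<forall>x y. ip (A x) y = ip x (B y))"

abbreviation cadjoint :: "('a::chilbert_space \<Rightarrow> 'a) \<Rightarrow> 'a \<Rightarrow> 'a" where
  "cadjoint \<equiv> adjoint_wrt cinner"

definition beta :: "nat \<Rightarrow> ('a::chilbert_space \<Rightarrow> 'a) \<Rightarrow> 'a \<Rightarrow> 'a" where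
  "beta m V = (\<lambda>x. \<Sum>k=0..m. ((-1) ^ (m - k) * real (m choose k)) *\<^sub>R
                      (cadjoint V ^^ k) ((V ^^ k) x))"

definition m_partial_isometry :: "nat \<Rightarrow> ('a::chilbert_space \<Rightarrow> 'a) \<Rightarrow> bool" where
  "m_partial_isometry m V \<longleftrightarrow> bounded_clinear V \<and> V \<circ> beta m V = (\<lambda>x. 0)"

definition similar_op :: "('a::chilbert_space \<Rightarrow> 'a) \<Rightarrow> ('a \<Rightarrow> 'a) \<Rightarrow> bool" where
  "similar_op A B \<longleftrightarrow>
     (\<exists>X Y. bounded_clinear X \<and> bounded_clinear Y \<and> Y \<circ> X = id \<and> X \<circ> Y = id \<and>
            A = Y \<circ> B \<circ> X)"

text \<open>The value at the identity of the operator transform \<open>\<Delta>\<^sup>m\<close> determined by \<open>A\<close> and \<open>B\<close>.\<close>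

definition Delta_I :: "nat \<Rightarrow> ('a::chilbert_space \<Rightarrow> 'a) \<Rightarrow> ('a \<Rightarrow> 'a) \<Rightarrow> 'a \<Rightarrow> 'a" where
  "Delta_I m A B = (\<lambda>x. \<Sum>k=0..m. ((-1) ^ k * real (m choose k)) *\<^sub>R
                           (A ^^ (m - k)) ((B ^^ (m - k)) x))"

text \<open>
  \<open>N\<close> is a norm equivalent to the given one, and \<open>ip\<close> is the inner product it comes from (by
  polarization, \<open>ip\<close> is determined by \<open>N\<close>).
\<close>

definition equivalent_hilbertian_norm ::
    "('a::chilbert_space \<Rightarrow> real) \<Rightarrow> ('a \<Rightarrow> 'a \<Rightarrow> complex) \<Rightarrow> bool" where
  "equivalent_hilbertian_norm N ip \<longleftrightarrow>
     complex_inner_product ip \<and> N = induced_norm ip \<and>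
     (\<exists>a>0. \<exists>b>0. \<forall>x. a * norm x \<le> N x \<and> N x \<le> b * norm x)"

definition m_concave_wrt :: "('a \<Rightarrow> real) \<Rightarrow> nat \<Rightarrow> ('a \<Rightarrow> 'a) \<Rightarrow> bool" where
  "m_concave_wrt N m A \<longleftrightarrow>
     (\<forall>x. (\<Sum>k=0..m. (-1) ^ (m - k) * real (m choose k) * (N ((A ^^ k) x))\<^sup>2) \<le> 0)"

end

theory Submission imports Defs begin

text \<open>
  For an equivalent inner product \<open>\<langle>x, y\<rangle>' = \<langle>P x, y\<rangle>\<close>, a suitable positive multiple of \<open>P\<close> has the
  form \<open>I - K\<close> with \<open>K\<close> selfadjoint of norm less than \<open>1\<close>; its square root \<open>X\<close> is an isomorphism
  carrying \<open>\<langle>_, _\<rangle>'\<close> to a multiple of the original inner product, and conjugation by \<open>X\<close> turns the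
  adjoint for the new inner product into the original adjoint.

  If \<open>T \<beta>\<^sub>m(T) = 0\<close>, then \<open>\<beta>\<^sub>m(T)\<close> maps into the kernel of \<open>T\<close>, where it acts as multiplication by
  \<open>(-1)\<^sup>m\<close>, so \<open>\<beta>\<^sub>m(T)\<^sup>2 = (-1)\<^sup>m \<beta>\<^sub>m(T)\<close>. As \<open>\<beta>\<^sub>m(T)\<close> is selfadjoint, it is nonpositive for odd \<open>m\<close>.
\<close>

section \<open>Inner products\<close>

lemma scaleC_zero_right [simp]: "c *\<^sub>C (0 :: 'a::complex_vector) = 0"
  using scaleC_add_right[of c 0 "0::'a"] by simp

lemma scaleC_diff_right: "c *\<^sub>C (x - y :: 'a::complex_vector) = c *\<^sub>C x - c *\<^sub>C y"
  using scaleC_add_right[of c "x - y" y] by (simp add: algebra_simps)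

lemma scaleC_scaleR: "c *\<^sub>C r *\<^sub>R x = r *\<^sub>R c *\<^sub>C (x :: 'a::complex_vector)"
  by (simp add: scaleR_scaleC scaleC_scaleC mult.commute)

context
  fixes ip :: "'a::complex_vector \<Rightarrow> 'a \<Rightarrow> complex"
  assumes ip: "complex_inner_product ip"
begin

lemma ip_add_left: "ip (x + y) z = ip x z + ip y z"
  using ip unfolding complex_inner_product_def by blast

lemma ip_scaleC_left: "ip (c *\<^sub>C x) y = c * ip x y"
  using ip unfolding complex_inner_product_def by blast

lemma ip_commute: "ip y x = cnj (ip x y)"
  using ip unfolding complex_inner_product_def by blast

lemma ip_pos: "x \<noteq> 0 \<Longrightarrow> Re (ip x x) > 0"
  using ip unfolding complex_inner_product_def by blast

lemma ip_add_right: "ip z (x + y) = ip z x + ip z y"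
  using ip_commute ip_add_left by (metis complex_cnj_add)

lemma ip_scaleC_right: "ip x (c *\<^sub>C y) = cnj c * ip x y"
  using ip_commute ip_scaleC_left by (metis complex_cnj_mult)

lemma ip_diff_left: "ip (x - y) z = ip x z - ip y z"
  using ip_add_left[of "x - y" y z] by simp

lemma ip_diff_right: "ip z (x - y) = ip z x - ip z y"
  using ip_add_right[of z "x - y" y] by simp

lemma ip_zero_left: "ip 0 z = 0"
  using ip_diff_left[of 0 0 z] by simp

lemma ip_zero_right: "ip z 0 = 0"
  using ip_diff_right[of z 0 0] by simp

lemma ip_scaleR_left: "ip (r *\<^sub>R x) y = of_real r * ip x y"
  by (simp add: scaleR_scaleC ip_scaleC_left)

lemma ip_scaleR_right: "ip x (r *\<^sub>R y) = of_real r * ip x y"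
  by (simp add: scaleR_scaleC ip_scaleC_right)

lemma ip_self_nonneg: "Re (ip x x) \<ge> 0"
  using ip_pos[of x] by (cases "x = 0") (auto simp: ip_zero_left)

lemma ip_self: "ip x x = of_real (Re (ip x x))"
  using ip_commute[of x x] by (simp add: complex_eq_iff)

lemma induced_norm_power2: "(induced_norm ip x)\<^sup>2 = Re (ip x x)"
  using ip_self_nonneg by (simp add: induced_norm_def)

lemma ip_Cauchy_Schwarz: "cmod (ip x y) \<le> induced_norm ip x * induced_norm ip y"
proof (cases "y = 0")
  case True
  then show ?thesis by (simp add: ip_zero_right induced_norm_def)
next
  case False
  define d where "d = Re (ip y y)"
  have d: "d > 0" and yy: "ip y y = of_real d"
    using ip_pos[OF False] ip_self[of y] by (simp_all add: d_def)
  \<comment> \<open>This is \<open>d\<close> times the component of \<open>x\<close> orthogonal to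
    \<open>y\<close>; the factor \<open>d\<close> avoids a division. Nonnegativity of its square is
    the inequality.\<close>
  define z where "z = of_real d *\<^sub>C x - ip x y *\<^sub>C y"
  have "ip z z = of_real d * (of_real d * ip x x - ip x y * cnj (ip x y))"
    by (simp add: z_def ip_diff_left ip_diff_right ip_scaleC_left ip_scaleC_right yy
        ip_commute[of y x] algebra_simps)
  also have "Re \<dots> = d * (d * Re (ip x x) - (cmod (ip x y))\<^sup>2)"
    unfolding complex_norm_square[symmetric] by simp
  finally have "0 \<le> d * (d * Re (ip x x) - (cmod (ip x y))\<^sup>2)"
    using ip_self_nonneg[of z] by simp
  then have "(cmod (ip x y))\<^sup>2 \<le> d * Re (ip x x)"
    using d by (simp add: zero_le_mult_iff)
  then have "(cmod (ip x y))\<^sup>2 \<le> (induced_norm ip x * induced_norm ip y)\<^sup>2"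
    by (simp add: power_mult_distrib induced_norm_power2 d_def mult.commute)
  then show ?thesis
    by (rule power2_le_imp_le) (simp add: induced_norm_def ip_self_nonneg)
qed

lemma ip_eqI: "(\<And>z. ip z x = ip z y) \<Longrightarrow> x = y"
  using ip_pos[of "x - y"] by (auto simp: ip_diff_right)

text \<open>Definiteness makes the described operator unique, so an adjoint can be identified by
  exhibiting any map with the adjoint relation.\<close>

lemma adjoint_wrt_eqI:
  assumes "\<And>x y. ip (A x) y = ip x (B y)"
  shows "adjoint_wrt ip A = B"
  unfolding adjoint_wrt_def
proof (rule the_equality)
  fix B' assume "\<forall>x y. ip (A x) y = ip x (B' y)"
  then show "B' = B" using assms by (intro ext ip_eqI) metis
qed (use assms in auto)

lemma ip_adjoint_funpow:
  assumes "\<And>x y. ip (A x) y = ip x (B y)"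
  shows "ip ((A ^^ k) x) y = ip x ((B ^^ k) y)"
  by (induction k arbitrary: x y) (simp_all add: assms funpow_swap1)

lemma ip_sum_left: "ip (sum f I) y = (\<Sum>i\<in>I. ip (f i) y)"
  by (induction I rule: infinite_finite_induct) (simp_all add: ip_zero_left ip_add_left)

end

lemmas ip_simps = ip_add_left ip_add_right ip_diff_left ip_diff_right ip_zero_left ip_zero_right
  ip_scaleC_left ip_scaleC_right ip_scaleR_left ip_scaleR_right

lemmas cinner_simps = ip_simps[OF cinner_inner_product]

lemmas cinner_commute = ip_commute[OF cinner_inner_product]

lemmas cinner_eqI = ip_eqI[OF cinner_inner_product]

lemmas cadjoint_eqI = adjoint_wrt_eqI[OF cinner_inner_product]

section \<open>Riesz representation and adjoints\<close>

lemma norm_power2_cinner: "(norm (x :: 'a::chilbert_space))\<^sup>2 = Re (cinner x x)"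
  by (simp add: norm_eq_induced_norm induced_norm_power2[OF cinner_inner_product])

lemma norm_add_scaleR_power2:
  "(norm (x + r *\<^sub>R y :: 'a::chilbert_space))\<^sup>2 = (norm x)\<^sup>2 + 2 * r * Re (cinner y x) + r\<^sup>2 * (norm y)\<^sup>2"
  unfolding norm_power2_cinner
  by (simp add: cinner_simps cinner_commute[of x y] algebra_simps power2_eq_square)

lemma norm_cinner_le: "cmod (cinner x y) \<le> norm x * norm (y :: 'a::chilbert_space)"
  using ip_Cauchy_Schwarz[OF cinner_inner_product] by (simp add: norm_eq_induced_norm)

lemma norm_scaleC: "norm (c *\<^sub>C x) = cmod c * norm (x :: 'a::chilbert_space)"
proof (rule power2_eq_imp_eq)
  have "cinner (c *\<^sub>C x) (c *\<^sub>C x) = (c * cnj c) * cinner x x"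
    by (simp add: cinner_simps)
  then show "(norm (c *\<^sub>C x))\<^sup>2 = (cmod c * norm x)\<^sup>2"
    by (simp add: norm_power2_cinner power_mult_distrib complex_norm_square[symmetric]
        del: of_real_power complex_mult_cnj)
qed auto

lemma bounded_linear_scaleC: "bounded_linear (\<lambda>x::'a::chilbert_space. c *\<^sub>C x)"
  by (rule bounded_linear_intro[where K = "cmod c"])
    (simp_all add: scaleC_add_right scaleC_scaleR norm_scaleC)

lemma bounded_linear_cinner_left: "bounded_linear (\<lambda>x::'a::chilbert_space. cinner x y)"
  by (rule bounded_linear_intro[where K = "norm y"])
    (simp_all add: cinner_simps norm_cinner_le scaleR_conv_of_real)

lemma bounded_linear_cinner_right: "bounded_linear (\<lambda>y::'a::chilbert_space. cinner x y)"
  by (rule bounded_linear_intro[where K = "norm x"])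
    (simp_all add: cinner_simps norm_cinner_le mult.commute[of _ "norm x"] scaleR_conv_of_real)

text \<open>The representing vector minimizes \<open>\<parallel>x\<parallel>\<^sup>2 - 2 Re (f x)\<close>.\<close>

lemma Riesz_representation:
  fixes f :: "'a::chilbert_space \<Rightarrow> complex"
  assumes add: "\<And>x y. f (x + y) = f x + f y"
    and scale: "\<And>c x. f (c *\<^sub>C x) = c * f x"
    and bound: "\<And>x. cmod (f x) \<le> M * norm x"
  obtains w where "\<And>x. f x = cinner x w"
proof -
  define J where "J x = (norm x)\<^sup>2 - 2 * Re (f x)" for x
  define d where "d = Inf (range J)"
  have scaleR: "f (r *\<^sub>R x) = of_real r * f x" for r x
    by (simp add: scaleR_scaleC scale)
  have "J x \<ge> - (M\<^sup>2)" for x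
  proof -
    have "Re (f x) \<le> M * norm x"
      using bound[of x] complex_Re_le_cmod[of "f x"] by linarith
    then show ?thesis
      using zero_le_power2[of "norm x - M"] by (simp add: J_def power2_diff mult_ac)
  qed
  then have bdd: "bdd_below (range J)" by (auto intro!: bdd_belowI)
  have d_le: "d \<le> J x" for x
    unfolding d_def by (rule cInf_lower[OF _ bdd]) auto
  have "\<exists>x. J x < d + inverse (real (Suc n))" for n
    using cInf_lessD[of "range J" "d + inverse (real (Suc n))"] by (auto simp: d_def)
  then obtain x where x: "\<And>n. J (x n) < d + inverse (real (Suc n))" by metis
  \<comment> \<open>The linear part of \<open>J\<close> cancels, leaving the parallelogram law.
    Since \<open>J\<close> is at least \<open>d\<close> at the midpoint, two values within
    \<open>e^2 / 4\<close> of \<open>d\<close> force the distance below \<open>e\<close>.\<close>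
  have parallelogram: "(norm (u - v))\<^sup>2 = 2 * J u + 2 * J v - 4 * J ((1/2) *\<^sub>R (u + v))" for u v
    by (simp add: J_def norm_power2_cinner cinner_simps add scaleR algebra_simps)
  have "Cauchy x"
  proof (rule metric_CauchyI)
    fix e :: real assume e: "e > 0"
    obtain N where N: "inverse (real (Suc N)) < e\<^sup>2 / 4"
      using reals_Archimedean[of "e\<^sup>2 / 4"] e by auto
    have "dist (x i) (x j) < e" if "i \<ge> N" "j \<ge> N" for i j
    proof -
      have le: "inverse (real (Suc k)) < e\<^sup>2 / 4" if "k \<ge> N" for k
      proof -
        have "inverse (real (Suc k)) \<le> inverse (real (Suc N))"
          using that by (intro le_imp_inverse_le) auto
        then show ?thesis using N by linarith
      qed
      have "(norm (x i - x j))\<^sup>2 < e\<^sup>2"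
        using parallelogram[of "x i" "x j"] d_le[of "(1/2) *\<^sub>R (x i + x j)"] x[of i] x[of j]
          le[OF that(1)] le[OF that(2)] by linarith
      then show ?thesis using e by (simp add: dist_norm power_less_imp_less_base)
    qed
    then show "\<exists>N. \<forall>i\<ge>N. \<forall>j\<ge>N. dist (x i) (x j) < e" by blast
  qed
  then obtain w where w: "x \<longlonglongrightarrow> w"
    using Cauchy_convergent convergent_def by blast
  have Re_eq: "Re (f y) = Re (cinner y w)" for y
  proof -
    define g where "g = Re (cinner y w) - Re (f y)"
    \<comment> \<open>First variation at the minimizer: the inequality
      \<open>d \<le> J (x n + t *\<^sub>R y)\<close> is passed to the limit along the minimizing
      sequence.\<close>
    have quad: "0 \<le> 2 * t * g + t\<^sup>2 * (norm y)\<^sup>2" for t :: real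
    proof (rule LIMSEQ_le_const)
      have "(\<lambda>n. inverse (real (Suc n)) + 2 * t * (Re (cinner y (x n)) - Re (f y))
          + t\<^sup>2 * (norm y)\<^sup>2) \<longlonglongrightarrow> 0 + 2 * t * g + t\<^sup>2 * (norm y)\<^sup>2"
        unfolding g_def
        by (intro tendsto_intros LIMSEQ_inverse_real_of_nat w
            bounded_linear.tendsto[OF bounded_linear_cinner_right])
      then show "(\<lambda>n. inverse (real (Suc n)) + 2 * t * (Re (cinner y (x n)) - Re (f y))
          + t\<^sup>2 * (norm y)\<^sup>2) \<longlonglongrightarrow> 2 * t * g + t\<^sup>2 * (norm y)\<^sup>2" by simp
      have "J (x n + t *\<^sub>R y) = J (x n) + 2 * t * (Re (cinner y (x n)) - Re (f y))
          + t\<^sup>2 * (norm y)\<^sup>2" for n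
        by (simp add: J_def norm_add_scaleR_power2 add scaleR algebra_simps)
      then have "0 \<le> inverse (real (Suc n)) + 2 * t * (Re (cinner y (x n)) - Re (f y))
          + t\<^sup>2 * (norm y)\<^sup>2" for n
        using d_le[of "x n + t *\<^sub>R y"] x[of n] by (smt (verit))
      then show "\<exists>N. \<forall>n\<ge>N. 0 \<le> inverse (real (Suc n))
          + 2 * t * (Re (cinner y (x n)) - Re (f y)) + t\<^sup>2 * (norm y)\<^sup>2" by blast
    qed
    have "g = 0"
    proof (rule ccontr)
      assume "g \<noteq> 0"
      \<comment> \<open>At \<open>t = - s * g\<close> the linear term outweighs the quadratic one;
        the added 1 keeps \<open>s\<close> well defined for \<open>y = 0\<close>.\<close>
      define s where "s = inverse ((norm y)\<^sup>2 + 1)"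
      have s: "s > 0" "s * (norm y)\<^sup>2 \<le> 1"
        by (auto simp: s_def field_simps add_pos_nonneg intro!: divide_le_eq_1_pos[THEN iffD2])
      have "2 * (- s * g) * g + (- s * g)\<^sup>2 * (norm y)\<^sup>2 = (s * g\<^sup>2) * (s * (norm y)\<^sup>2 - 2)"
        by (simp add: power2_eq_square algebra_simps)
      moreover have "(s * g\<^sup>2) * (s * (norm y)\<^sup>2 - 2) < 0"
        using s \<open>g \<noteq> 0\<close> by (intro mult_pos_neg) auto
      ultimately show False using quad[of "- s * g"] by linarith
    qed
    then show ?thesis by (simp add: g_def)
  qed
  have "f y = cinner y w" for y
    \<comment> \<open>Evaluating at \<open>\<i> *\<^sub>C y\<close> turns imaginary parts into real
      parts.\<close>
    using Re_eq[of y] Re_eq[of "\<i> *\<^sub>C y"] by (simp add: scale cinner_simps complex_eq_iff)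
  then show thesis by (rule that)
qed

section \<open>Bounded complex-linear operators, bounded forms and adjoints\<close>

lemma bounded_clinearI:
  assumes "\<And>x y. A (x + y) = A x + A y" and "\<And>c x. A (c *\<^sub>C x) = c *\<^sub>C A x"
    and "\<And>x. norm (A x) \<le> M * norm x"
  shows "bounded_clinear (A :: 'a::chilbert_space \<Rightarrow> 'a)"
  unfolding bounded_clinear_def
  using assms
  by (auto intro!: bounded_linear_intro[where K = M] simp: scaleR_scaleC mult.commute)

lemma bounded_clinearD:
  assumes "bounded_clinear A"
  shows "bounded_linear A" "A (x + y) = A x + A y" "A (x - y) = A x - A y" "A 0 = 0"
    "A (c *\<^sub>C x) = c *\<^sub>C A x" "A (r *\<^sub>R x) = r *\<^sub>R A x" "A (sum f I) = (\<Sum>i\<in>I. A (f i))"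
  using assms unfolding bounded_clinear_def
  by (auto simp: linear_simps linear_sum bounded_linear.linear)

lemma bounded_clinear_bound:
  assumes "bounded_clinear A"
  obtains M where "M > 0" "\<And>x. norm (A x) \<le> M * norm x"
  using bounded_linear.pos_bounded[OF bounded_clinearD(1)[OF assms]] by (metis mult.commute)

lemma bounded_clinear_compose:
  assumes "bounded_clinear A" "bounded_clinear B"
  shows "bounded_clinear (A \<circ> B)"
  using assms bounded_linear_compose[of A B] unfolding bounded_clinear_def by (simp add: o_def)

text \<open>Riesz representation in the first argument for each fixed \<open>y\<close>; conjugate
  linearity of \<open>h\<close> in \<open>y\<close> makes the representing vector depend linearly on
  \<open>y\<close>. This yields both adjoints and Gram operators.\<close>

lemma bounded_form_operator:
  fixes h :: "'a::chilbert_space \<Rightarrow> 'a \<Rightarrow> complex"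
  assumes add: "\<And>x y z. h (x + y) z = h x z + h y z" "\<And>x y z. h z (x + y) = h z x + h z y"
    and scale: "\<And>c x y. h (c *\<^sub>C x) y = c * h x y" "\<And>c x y. h x (c *\<^sub>C y) = cnj c * h x y"
    and bound: "\<And>x y. cmod (h x y) \<le> M * norm x * norm y"
  obtains B where "bounded_clinear B" "\<And>x y. h x y = cinner x (B y)"
    "\<And>y. norm (B y) \<le> M * norm y"
proof -
  have "\<exists>w. \<forall>x. h x y = cinner x w" for y
    by (rule Riesz_representation[of "\<lambda>x. h x y" "M * norm y"])
      (use add scale bound[of _ y] in \<open>auto simp: mult_ac\<close>)
  then obtain B where B: "\<And>x y. h x y = cinner x (B y)" by metis
  have norm_B: "norm (B y) \<le> M * norm y" for y
  \<comment> \<open>Cancelling \<open>norm (B y)\<close> requires it to be nonzero. Otherwise the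
    sign of \<open>M * norm y\<close> must be read off the bound at \<open>(y, y)\<close>, as
    \<open>M\<close> may be negative.\<close>
  proof (cases "B y = 0")
    case True
    then show ?thesis
      using order_trans[OF norm_ge_zero bound[of y y]] by (cases "y = 0") (auto simp: zero_le_mult_iff)
  next
    case False
    have "(norm (B y))\<^sup>2 \<le> cmod (h (B y) y)"
      by (simp add: norm_power2_cinner B complex_Re_le_cmod)
    also have "\<dots> \<le> M * norm (B y) * norm y" by (rule bound)
    finally show ?thesis using False by (simp add: power2_eq_square)
  qed
  have "bounded_clinear B"
    by (rule bounded_clinearI[OF _ _ norm_B]; rule cinner_eqI)
      (simp_all add: cinner_simps add scale flip: B)
  then show thesis using B norm_B by (rule that)
qed

lemma cadjoint_exists:
  fixes A :: "'a::chilbert_space \<Rightarrow> 'a"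
  assumes A: "bounded_clinear A"
  shows "bounded_clinear (cadjoint A)" and "cinner (A x) y = cinner x (cadjoint A y)"
proof -
  obtain M where M: "\<And>x. norm (A x) \<le> M * norm x" using bounded_clinear_bound[OF A] by metis
  have bd: "cmod (cinner (A x) y) \<le> M * norm x * norm y" for x y
    using norm_cinner_le[of "A x" y] mult_right_mono[OF M[of x] norm_ge_zero[of y]] by linarith
  obtain B where B: "bounded_clinear B" "\<And>x y. cinner (A x) y = cinner x (B y)"
    by (rule bounded_form_operator[of "\<lambda>x y. cinner (A x) y" M])
      (auto simp: bounded_clinearD[OF A] cinner_simps bd)
  moreover from B(2) have "cadjoint A = B" by (rule cadjoint_eqI)
  ultimately show "bounded_clinear (cadjoint A)" "cinner (A x) y = cinner x (cadjoint A y)"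
    by auto
qed

lemma cadjoint_cadjoint:
  assumes "bounded_clinear A"
  shows "cadjoint (cadjoint A) = A"
  by (rule cadjoint_eqI) (metis cadjoint_exists(2)[OF assms] cinner_commute)

section \<open>Square roots\<close>

text \<open>\<open>I - Y\<close> is a square root of \<open>I - K\<close> iff \<open>Y\<close> is a fixed point of \<open>Y \<mapsto> (K + Y\<^sup>2) / 2\<close>, which is
  a contraction of the ball of radius \<open>q\<close>.\<close>

lemma sqrt_id_minus:
  fixes K :: "'a::chilbert_space \<Rightarrow>\<^sub>L 'a"
  assumes q: "q < 1" and norm_K: "norm K \<le> q"
    and K_scale: "\<And>c x. K (c *\<^sub>C x) = c *\<^sub>C K x"
    and K_adj: "\<And>x y. cinner (K x) y = cinner x (K y)"
  obtains Y :: "'a \<Rightarrow>\<^sub>L 'a" where "norm Y \<le> q" "\<And>c x. Y (c *\<^sub>C x) = c *\<^sub>C Y x"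
    "\<And>x y. cinner (Y x) y = cinner x (Y y)"
    "\<And>x. x - K x = (x - Y x) - Y (x - Y x)"
proof -
  \<comment> \<open>Complex linearity and selfadjointness are closed conditions preserved by
    \<open>F\<close>, so building them into \<open>S\<close> passes them on to the fixed
    point.\<close>
  define S where "S = {Y :: 'a \<Rightarrow>\<^sub>L 'a. norm Y \<le> q} \<inter>
    ({Y. \<forall>c x. blinfun_apply Y (c *\<^sub>C x) = c *\<^sub>C Y x} \<inter> {Y. \<forall>x y. cinner (blinfun_apply Y x) y = cinner x (Y y)})"
  define F where "F Y = (1/2) *\<^sub>R (K + (Y o\<^sub>L Y))" for Y
  have q0: "q \<ge> 0" using norm_K norm_ge_zero[of K] by linarith
  have "closed S"
    unfolding S_def
    by (intro closed_Int closed_Collect_all closed_Collect_eq closed_Collect_le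
        bounded_linear.continuous_on[OF bounded_linear_scaleC]
        bounded_linear.continuous_on[OF bounded_linear_cinner_left]
        bounded_linear.continuous_on[OF bounded_linear_cinner_right] continuous_intros)
  then have "complete S" by (simp add: complete_eq_closed)
  moreover have "0 \<in> S"
    using q0 by (simp add: S_def cinner_simps)
  then have "S \<noteq> {}" by blast
  moreover have "F ` S \<subseteq> S"
  proof clarify
    fix Y assume "Y \<in> S"
    then have Y: "norm Y \<le> q" "\<And>c x. Y (c *\<^sub>C x) = c *\<^sub>C Y x"
      "\<And>x y. cinner (Y x) y = cinner x (Y y)" by (auto simp: S_def)
    have "norm (Y o\<^sub>L Y) \<le> q * 1"
      by (rule order_trans[OF norm_blinfun_compose]) (use Y q q0 in \<open>intro mult_mono; auto\<close>)
    then have "norm (F Y) \<le> q"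
      using norm_triangle_ineq[of K "Y o\<^sub>L Y"] norm_K by (simp add: F_def)
    moreover have "F Y (c *\<^sub>C x) = c *\<^sub>C F Y x" for c x
      by (simp add: F_def blinfun.bilinear_simps Y K_scale scaleC_scaleR scaleC_add_right)
    moreover have "cinner (F Y x) y = cinner x (F Y y)" for x y
      by (simp add: F_def blinfun.bilinear_simps cinner_simps K_adj Y)
    ultimately show "F Y \<in> S" by (simp add: S_def)
  qed
  moreover have "dist (F Y) (F Z) \<le> q * dist Y Z" if "Y \<in> S" "Z \<in> S" for Y Z
  proof -
    have n: "norm Y \<le> q" "norm Z \<le> q" using that by (auto simp: S_def)
    \<comment> \<open>The splitting \<open>Y^2 - Z^2 = Y (Y - Z) + (Y - Z) Z\<close> respects the
      order of the factors and gives the contraction constant \<open>q\<close>.\<close>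
    have "F Y - F Z = (1/2) *\<^sub>R ((Y o\<^sub>L (Y - Z)) + ((Y - Z) o\<^sub>L Z))"
      by (rule blinfun_eqI) (simp add: F_def blinfun.bilinear_simps algebra_simps)
    then have "norm (F Y - F Z) \<le> (norm (Y o\<^sub>L (Y - Z)) + norm ((Y - Z) o\<^sub>L Z)) / 2"
      using norm_triangle_ineq[of "Y o\<^sub>L (Y - Z)" "(Y - Z) o\<^sub>L Z"] by simp
    also have "\<dots> \<le> (q * norm (Y - Z) + norm (Y - Z) * q) / 2"
      by (intro divide_right_mono add_mono order_trans[OF norm_blinfun_compose] mult_mono)
        (use n q0 in auto)
    finally show ?thesis by (simp add: dist_norm)
  qed
  ultimately obtain Y where Y: "Y \<in> S" "F Y = Y"
    using Banach_fix[of S q F] q q0 by blast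
  have "Y x = (1/2) *\<^sub>R (K x + Y (Y x))" for x
    using arg_cong[OF Y(2), of "\<lambda>Z. blinfun_apply Z x"]
    by (simp add: F_def blinfun.bilinear_simps)
  then have "Y x + Y x = K x + Y (Y x)" for x
    by (metis scaleR_half_double scaleR_right_distrib)
  then have "x - K x = (x - Y x) - Y (x - Y x)" for x
    by (simp add: blinfun.bilinear_simps algebra_simps)
  then show thesis using Y(1) by (intro that[of Y]) (auto simp: S_def)
qed

text \<open>Solving \<open>x - Y x = z\<close> means finding a fixed point of the contraction
  sending \<open>x\<close> to \<open>z + Y x\<close>; its uniqueness also makes the solution linear
  in \<open>z\<close>.\<close>

lemma id_minus_invertible:
  fixes Y :: "'a::chilbert_space \<Rightarrow>\<^sub>L 'a"
  assumes norm_Y: "norm Y < 1" and scale: "\<And>c x. Y (c *\<^sub>C x) = c *\<^sub>C Y x"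
  obtains Z where "bounded_clinear Z" "\<And>x. Z (x - Y x) = x" "\<And>z. Z z - Y (Z z) = z"
proof -
  have "\<exists>!x. z + Y x = x" for z
  proof (rule banach_fix_type[of "norm Y"])
    show "\<forall>x y. dist (z + Y x) (z + Y y) \<le> norm Y * dist x y"
      by (simp add: dist_norm blinfun.diff_right[symmetric] norm_blinfun)
  qed (use norm_Y in auto)
  then have ex1: "\<exists>!x. x - Y x = z" for z
    by (metis (no_types, lifting) add_diff_cancel_right' diff_add_cancel)
  define Z where "Z z = (THE x. x - Y x = z)" for z
  have right: "Z z - Y (Z z) = z" for z
    unfolding Z_def by (rule theI'[OF ex1])
  have eqI: "Z z = x" if "x - Y x = z" for x z
    using ex1[of z] right[of z] that by blast
  have bound: "norm (Z z) \<le> inverse (1 - norm Y) * norm z" for z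
  proof -
    have "norm (Z z) \<le> norm z + norm Y * norm (Z z)"
      using norm_triangle_ineq[of z "Y (Z z)"] norm_blinfun[of Y "Z z"] right[of z]
      by (smt (verit) diff_add_cancel)
    then show ?thesis using norm_Y by (simp add: field_simps)
  qed
  have "bounded_clinear Z"
    by (rule bounded_clinearI[OF _ _ bound])
      (auto intro!: eqI simp: blinfun.bilinear_simps scale right add_diff_add
        simp flip: scaleC_diff_right)
  then show thesis using right eqI by (intro that[of Z]) auto
qed

text \<open>With \<open>a\<^sup>2 \<le> P \<le> b\<^sup>2\<close> for the Gram operator \<open>P\<close> of \<open>ip\<close>, the choice \<open>c = a\<^sup>2 / b\<^sup>4\<close> gives
  \<open>\<parallel>I - c P\<parallel>\<^sup>2 \<le> 1 - a\<^sup>4 / b\<^sup>4\<close>, as in the proof of the Lax-Milgram theorem.\<close>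

lemma equivalent_inner_product_isomorphism:
  fixes ip :: "'a::chilbert_space \<Rightarrow> 'a \<Rightarrow> complex"
  assumes eq: "equivalent_hilbertian_norm N ip"
  obtains X Z c where "bounded_clinear X" "bounded_clinear Z" "Z \<circ> X = id" "X \<circ> Z = id"
    "c > 0" "\<And>x y. cinner (X x) (X y) = of_real c * ip x y"
proof -
  obtain a b where ip: "complex_inner_product ip" and ab: "a > 0" "b > 0"
    and lower: "\<And>x. a * norm x \<le> induced_norm ip x"
    and upper: "\<And>x. induced_norm ip x \<le> b * norm x"
    using eq unfolding equivalent_hilbertian_norm_def by auto
  note simps = ip_simps[OF ip]
  have ip_bound: "cmod (ip x y) \<le> b\<^sup>2 * norm x * norm y" for x y
  proof -
    have "induced_norm ip x * induced_norm ip y \<le> (b * norm x) * (b * norm y)"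
      by (intro mult_mono upper)
        (use ab ip_self_nonneg[OF ip] in \<open>auto simp: induced_norm_def\<close>)
    then show ?thesis
      using ip_Cauchy_Schwarz[OF ip, of x y] by (simp add: power2_eq_square mult_ac)
  qed
  obtain P where P: "bounded_clinear P" and ip_P: "\<And>x y. ip x y = cinner x (P y)"
    and norm_P: "\<And>y. norm (P y) \<le> b\<^sup>2 * norm y"
    by (rule bounded_form_operator[of ip "b\<^sup>2"]) (auto simp: simps ip_bound)
  have P_adj: "cinner (P x) y = cinner x (P y)" for x y
    by (metis ip_P ip_commute[OF ip] cinner_commute)
  define c where "c = a\<^sup>2 / b^4"
  \<comment> \<open>On the zero space \<open>a > b\<close> is possible, so \<open>max\<close> keeps
    the radicand nonnegative.\<close>
  define q where "q = sqrt (max 0 (1 - a^4 / b^4))"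
  have c: "c > 0" using ab by (simp add: c_def)
  have bounded: "bounded_linear (\<lambda>x. x - c *\<^sub>R P x)"
    by (intro bounded_linear_intros bounded_clinearD(1)[OF P])
  define K where "K = Blinfun (\<lambda>x. x - c *\<^sub>R P x)"
  have K: "blinfun_apply K x = x - c *\<^sub>R P x" for x
    unfolding K_def using bounded by (simp add: bounded_linear_Blinfun_apply)
  have norm_K2: "(norm (x - c *\<^sub>R P x))\<^sup>2 \<le> (1 - a^4 / b^4) * (norm x)\<^sup>2" for x
  proof -
    have "(norm (x - c *\<^sub>R P x))\<^sup>2 = (norm x)\<^sup>2 - 2 * c * Re (ip x x) + c\<^sup>2 * (norm (P x))\<^sup>2"
      using norm_add_scaleR_power2[of x "- c" "P x"] by (simp add: P_adj ip_P)
    moreover have "c * (a * norm x)\<^sup>2 \<le> c * Re (ip x x)"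
      using power_mono[OF lower[of x], of 2] ab c by (simp add: induced_norm_power2[OF ip])
    moreover have "c\<^sup>2 * (norm (P x))\<^sup>2 \<le> c\<^sup>2 * (b\<^sup>2 * norm x)\<^sup>2"
      by (intro mult_left_mono power_mono norm_P) auto
    moreover have "(norm x)\<^sup>2 - 2 * (c * (a * norm x)\<^sup>2) + c\<^sup>2 * (b\<^sup>2 * norm x)\<^sup>2
        = (1 - a^4 / b^4) * (norm x)\<^sup>2"
      using ab by (simp add: c_def field_simps power2_eq_square power4_eq_xxxx)
    ultimately show ?thesis by linarith
  qed
  have "norm (K x) \<le> q * norm x" for x
  proof (rule power2_le_imp_le)
    have "(1 - a^4 / b^4) * (norm x)\<^sup>2 \<le> max 0 (1 - a^4 / b^4) * (norm x)\<^sup>2"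
      by (intro mult_right_mono) auto
    then show "(norm (K x))\<^sup>2 \<le> (q * norm x)\<^sup>2"
      using norm_K2[of x] by (simp add: K q_def power_mult_distrib)
  qed (simp add: q_def)
  then have norm_K: "norm K \<le> q" by (intro norm_blinfun_bound) (simp_all add: q_def)
  have q: "q < 1" using ab by (simp add: q_def)
  obtain Y :: "'a \<Rightarrow>\<^sub>L 'a" where Y: "norm Y \<le> q" "\<And>c x. Y (c *\<^sub>C x) = c *\<^sub>C Y x"
    "\<And>x y. cinner (Y x) y = cinner x (Y y)"
    "\<And>x. x - K x = (x - Y x) - Y (x - Y x)"
    by (rule sqrt_id_minus[OF q norm_K])
      (auto simp: K bounded_clinearD[OF P] scaleC_diff_right scaleC_scaleR cinner_simps P_adj)
  obtain Z where Z: "bounded_clinear Z" "\<And>x. Z (x - Y x) = x" "\<And>z. Z z - Y (Z z) = z"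
    using id_minus_invertible[of Y] Y(1,2) q by (metis order_le_less_trans)
  define X where "X x = x - Y x" for x
  have "norm (X x) \<le> (1 + norm Y) * norm x" for x
    using norm_triangle_ineq4[of x "Y x"] norm_blinfun[of Y x] by (simp add: X_def algebra_simps)
  then have "bounded_clinear X"
    by (intro bounded_clinearI[of X "1 + norm Y"])
      (auto simp: X_def blinfun.bilinear_simps Y(2) scaleC_diff_right)
  moreover have "cinner (X x) (X y) = of_real c * ip x y" for x y
  proof -
    \<comment> \<open>\<open>X\<close> is selfadjoint with \<open>X^2 = I - K = c P\<close>, so
      moving it to the right factor produces the Gram operator.\<close>
    have "cinner (X x) (X y) = cinner x (X y - Y (X y))"
      unfolding X_def[of x] cinner_simps Y(3) ..
    also have "X y - Y (X y) = c *\<^sub>R P y"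
      using Y(4)[of y] by (simp add: X_def K)
    finally show ?thesis by (simp add: cinner_simps ip_P)
  qed
  ultimately show thesis
    using Z c by (intro that[of X Z c]) (auto simp: X_def fun_eq_iff)
qed

section \<open>Conjugation and concavity\<close>

text \<open>Reindexing by \<open>m - k\<close> matches the order of summation in \<open>beta\<close>
  and in \<open>m_concave_wrt\<close>.\<close>

lemma Delta_I_rev:
  "Delta_I m A B x = (\<Sum>k=0..m. ((-1) ^ (m - k) * real (m choose k)) *\<^sub>R (A ^^ k) ((B ^^ k) x))"
  unfolding Delta_I_def
  by (subst sum.atLeastAtMost_rev) (auto intro!: sum.cong simp: binomial_symmetric[symmetric])

lemma beta_eq_Delta_I: "beta m V = Delta_I m (cadjoint V) V"
  by (simp add: fun_eq_iff beta_def Delta_I_rev)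

lemma funpow_conjugate:
  assumes "Z \<circ> X = id" "X \<circ> Z = id"
  shows "((Z \<circ> A \<circ> X) ^^ k) x = Z ((A ^^ k) (X x))"
  using assms by (induction k) (simp_all add: fun_eq_iff)

lemma Delta_I_conjugate:
  assumes "bounded_clinear Z" "Z \<circ> X = id" "X \<circ> Z = id"
  shows "Delta_I m (Z \<circ> A \<circ> X) (Z \<circ> B \<circ> X) x = Z (Delta_I m A B (X x))"
  using assms(3) unfolding Delta_I_def funpow_conjugate[OF assms(2,3)]
  by (simp add: bounded_clinearD[OF assms(1)] fun_eq_iff)

text \<open>The left product at \<open>x\<close> is \<open>Z\<close> applied to the right product at
  \<open>X x\<close>. Vanishing transfers because \<open>X\<close> is onto and \<open>Z\<close> is
  injective with \<open>Z 0 = 0\<close>.\<close>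

lemma comp_Delta_I_conjugate:
  assumes Z: "bounded_clinear Z" and inv: "Z \<circ> X = id" "X \<circ> Z = id"
  shows "(Z \<circ> B \<circ> X) \<circ> Delta_I m (Z \<circ> A \<circ> X) (Z \<circ> B \<circ> X) = (\<lambda>x. 0) \<longleftrightarrow>
    B \<circ> Delta_I m A B = (\<lambda>x. 0)"
proof -
  have XZ: "X (Z x) = x" and ZX: "Z (X x) = x" for x using inv by (simp_all add: fun_eq_iff)
  have "(Z \<circ> B \<circ> X) (Delta_I m (Z \<circ> A \<circ> X) (Z \<circ> B \<circ> X) x) = Z (B (Delta_I m A B (X x)))" for x
    by (simp only: Delta_I_conjugate[OF assms] o_apply XZ)
  then show ?thesis
    unfolding fun_eq_iff o_apply[of "Z \<circ> B \<circ> X"] by (metis XZ ZX bounded_clinearD(4)[OF Z] o_apply)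
qed

text \<open>Up to the factor \<open>c\<close>, \<open>X\<close> is an isometry from
  \<open>ip\<close> to \<open>cinner\<close>. The factor cancels from both sides of the adjoint
  relation.\<close>

lemma adjoint_wrt_conjugate:
  assumes ip: "complex_inner_product ip" and V: "bounded_clinear V"
    and inv: "Z \<circ> X = id" "X \<circ> Z = id"
    and c: "c > 0" "\<And>x y. cinner (X x) (X y) = of_real c * ip x y"
  shows "ip ((Z \<circ> V \<circ> X) x) y = ip x ((Z \<circ> cadjoint V \<circ> X) y)"
    and "adjoint_wrt ip (Z \<circ> V \<circ> X) = Z \<circ> cadjoint V \<circ> X"
proof -
  have XZ: "X (Z x) = x" for x using inv by (simp add: fun_eq_iff)
  show *: "ip ((Z \<circ> V \<circ> X) x) y = ip x ((Z \<circ> cadjoint V \<circ> X) y)" for x y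
    using c(1) cadjoint_exists(2)[OF V, of "X x" "X y"]
      c(2)[of "Z (V (X x))" y] c(2)[of x "Z (cadjoint V (X y))"] by (simp add: XZ)
  show "adjoint_wrt ip (Z \<circ> V \<circ> X) = Z \<circ> cadjoint V \<circ> X"
    by (rule adjoint_wrt_eqI[OF ip]) (rule *)
qed

text \<open>The bridge for both directions of the equivalence: one starts from \<open>V\<close> and
  pulls back the inner product, the other starts from \<open>ip\<close> and constructs
  \<open>V\<close>.\<close>

lemma conjugate_m_partial_isometry_iff:
  assumes ip: "complex_inner_product ip" and V: "bounded_clinear V" and Z: "bounded_clinear Z"
    and inv: "Z \<circ> X = id" "X \<circ> Z = id"
    and c: "c > 0" "\<And>x y. cinner (X x) (X y) = of_real c * ip x y"
    and T: "T = Z \<circ> V \<circ> X"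
  shows "T \<circ> Delta_I m (adjoint_wrt ip T) T = (\<lambda>x. 0) \<longleftrightarrow> m_partial_isometry m V"
    and "adjoint_wrt ip T \<circ> Delta_I m T (adjoint_wrt ip T) = (\<lambda>x. 0) \<longleftrightarrow>
      m_partial_isometry m (cadjoint V)"
proof -
  have T': "adjoint_wrt ip T = Z \<circ> cadjoint V \<circ> X"
    unfolding T by (rule adjoint_wrt_conjugate(2)[OF ip V inv c])
  show "T \<circ> Delta_I m (adjoint_wrt ip T) T = (\<lambda>x. 0) \<longleftrightarrow> m_partial_isometry m V"
    unfolding T' m_partial_isometry_def beta_eq_Delta_I
    unfolding T comp_Delta_I_conjugate[OF Z inv] using V by simp
  show "adjoint_wrt ip T \<circ> Delta_I m T (adjoint_wrt ip T) = (\<lambda>x. 0) \<longleftrightarrow>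
      m_partial_isometry m (cadjoint V)"
    unfolding T' m_partial_isometry_def beta_eq_Delta_I cadjoint_cadjoint[OF V]
    unfolding T comp_Delta_I_conjugate[OF Z inv] using cadjoint_exists(1)[OF V] by simp
qed

text \<open>Formulated for a mutually adjoint pair, so that it applies to \<open>T\<close> and, with
  the roles exchanged, to its adjoint.\<close>

lemma m_concave_if_comp_Delta_I_zero:
  assumes ip: "complex_inner_product ip" and adj: "\<And>x y. ip (A x) y = ip x (B y)"
    and zero: "A \<circ> Delta_I m B A = (\<lambda>x. 0)" and "odd m"
  shows "m_concave_wrt (induced_norm ip) m A"
  unfolding m_concave_wrt_def
proof
  fix x
  let ?D = "Delta_I m B A"
  note simps = ip_simps[OF ip]
  have adj': "ip (B x) y = ip x (A y)" for x y
    by (metis adj ip_commute[OF ip])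
  \<comment> \<open>Linearity is not assumed; the values at 0 come from the adjoint relation and
    definiteness.\<close>
  have B0: "B 0 = 0"
    by (rule ip_eqI[OF ip]) (simp add: simps flip: adj)
  have Bk0: "(B ^^ k) 0 = 0" for k by (induction k) (simp_all add: B0)
  have A0: "A 0 = 0"
    by (rule ip_eqI[OF ip]) (simp add: simps flip: adj')
  have Ak: "(A ^^ Suc k) (?D y) = 0" for k y
    using fun_cong[OF zero, of y] A0 by (induction k) simp_all
  have D: "?D (?D y) = - ?D y" for y
  proof -
    \<comment> \<open>Every positive power of \<open>A\<close> annihilates the range of
      \<open>?D\<close>; only the term \<open>k = 0\<close>, with coefficient
      \<open>(-1) ^ m\<close>, survives.\<close>
    have "?D (?D y) = (\<Sum>k=0..m. if k = 0 then (-1) ^ m *\<^sub>R ?D y else 0)"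
      unfolding Delta_I_rev[of m B A "?D y"]
    proof (rule sum.cong)
      fix k
      show "((-1) ^ (m - k) * real (m choose k)) *\<^sub>R (B ^^ k) ((A ^^ k) (?D y)) =
          (if k = 0 then (-1) ^ m *\<^sub>R ?D y else 0)"
        by (cases k) (simp_all only: Ak Bk0, simp_all)
    qed simp
    then show ?thesis using \<open>odd m\<close> by simp
  qed
  \<comment> \<open>This form is Hermitian, which gives selfadjointness of \<open>?D\<close>; on the
    diagonal its real part is the sum in the concavity condition.\<close>
  have quad: "ip (?D y) z = (\<Sum>k=0..m. of_real ((-1) ^ (m - k) * real (m choose k)) *
      ip ((A ^^ k) y) ((A ^^ k) z))" for y z
    unfolding Delta_I_rev ip_sum_left[OF ip] ip_scaleR_left[OF ip]
    by (simp only: ip_adjoint_funpow[OF ip adj'])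
  have "ip (?D (?D x)) x = ip (?D x) (?D x)"
  proof -
    have "ip (?D y) z = cnj (ip (?D z) y)" for y z
      unfolding quad cnj_sum by (intro sum.cong) (simp_all add: ip_commute[OF ip, of "(A ^^ _) z"])
    then show ?thesis by (metis ip_commute[OF ip])
  qed
  then have "ip (?D x) x = - ip (?D x) (?D x)"
    unfolding D using ip_diff_left[OF ip, of 0 "?D x" x] by (simp add: simps)
  then have "Re (ip (?D x) x) \<le> 0" using ip_self_nonneg[OF ip, of "?D x"] by simp
  then show "(\<Sum>k=0..m. (-1) ^ (m - k) * real (m choose k) * (induced_norm ip ((A ^^ k) x))\<^sup>2) \<le> 0"
    unfolding quad Re_sum induced_norm_power2[OF ip] by simp
qed

section \<open>Similarity and equivalent Hilbertian norms\<close>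

theorem theorem5p7:
  fixes T :: "'a::chilbert_space \<Rightarrow> 'a" and m :: nat
  assumes "bounded_clinear T" and "m \<ge> 1"
  shows "((\<exists>V. similar_op T V \<and> m_partial_isometry m V \<and> m_partial_isometry m (cadjoint V)) \<longleftrightarrow>
          (\<exists>N ip. equivalent_hilbertian_norm N ip \<and>
             T \<circ> Delta_I m (adjoint_wrt ip T) T = (\<lambda>x. 0) \<and>
             adjoint_wrt ip T \<circ> Delta_I m T (adjoint_wrt ip T) = (\<lambda>x. 0))) \<and>
         (odd m \<longrightarrow>
          (\<forall>N ip. equivalent_hilbertian_norm N ip \<and>
             T \<circ> Delta_I m (adjoint_wrt ip T) T = (\<lambda>x. 0) \<and>
             adjoint_wrt ip T \<circ> Delta_I m T (adjoint_wrt ip T) = (\<lambda>x. 0) \<longrightarrow>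
             m_concave_wrt N m T \<and> m_concave_wrt N m (adjoint_wrt ip T)))"
proof (intro conjI iffI impI allI; (elim exE conjE)?)
  fix V
  assume "similar_op T V" and V: "m_partial_isometry m V" "m_partial_isometry m (cadjoint V)"
  then obtain X Z where X: "bounded_clinear X" and Z: "bounded_clinear Z"
    and inv: "Z \<circ> X = id" "X \<circ> Z = id" and T: "T = Z \<circ> V \<circ> X"
    unfolding similar_op_def by blast
  \<comment> \<open>Pulling back along \<open>X\<close> makes \<open>X\<close> an isometry onto the
    original space, so the scaling constant below is 1.\<close>
  define ip where "ip x y = cinner (X x) (X y)" for x y
  have ZX: "Z (X x) = x" for x using inv by (simp add: fun_eq_iff)
  have ip: "complex_inner_product ip"
    unfolding complex_inner_product_def
  proof (intro conjI allI impI)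
    fix x :: 'a assume "x \<noteq> 0"
    then have "X x \<noteq> 0" by (metis ZX bounded_clinearD(4)[OF Z])
    then show "Re (ip x x) > 0"
      unfolding ip_def by (rule ip_pos[OF cinner_inner_product])
  qed (simp_all add: ip_def bounded_clinearD[OF X] cinner_simps flip: cinner_commute)
  have norm: "induced_norm ip x = norm (X x)" for x
    by (simp add: induced_norm_def ip_def norm_eq_induced_norm)
  obtain M L where bd: "M > 0" "\<And>x. norm (X x) \<le> M * norm x" "L > 0" "\<And>x. norm (Z x) \<le> L * norm x"
    using bounded_clinear_bound[OF X] bounded_clinear_bound[OF Z] by metis
  have "equivalent_hilbertian_norm (induced_norm ip) ip"
    unfolding equivalent_hilbertian_norm_def norm
  proof (intro conjI exI allI ip refl)
    \<comment> \<open>The lower bound comes from \<open>x = Z (X x)\<close> and the bound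
      \<open>L\<close> on \<open>Z\<close>.\<close>
    show "inverse L * norm x \<le> norm (X x)" for x
      using bd(3) bd(4)[of "X x"] by (simp add: ZX field_simps)
  qed (use bd in auto)
  moreover have "bounded_clinear V" using V by (simp add: m_partial_isometry_def)
  ultimately show "\<exists>N ip. equivalent_hilbertian_norm N ip \<and>
      T \<circ> Delta_I m (adjoint_wrt ip T) T = (\<lambda>x. 0) \<and>
      adjoint_wrt ip T \<circ> Delta_I m T (adjoint_wrt ip T) = (\<lambda>x. 0)"
    using V conjugate_m_partial_isometry_iff[OF ip _ Z inv, of V 1 T m] T
    by (auto simp: ip_def)
next
  \<comment> \<open>The converse and both concavity claims start from the same norm and share this
    block; \<open>odd m\<close> enters only in the last two.\<close>
  fix N ip
  assume eq: "equivalent_hilbertian_norm N ip"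
    and T0: "T \<circ> Delta_I m (adjoint_wrt ip T) T = (\<lambda>x. 0)"
      "adjoint_wrt ip T \<circ> Delta_I m T (adjoint_wrt ip T) = (\<lambda>x. 0)"
  then have ip: "complex_inner_product ip" and N: "N = induced_norm ip"
    by (auto simp: equivalent_hilbertian_norm_def)
  obtain X Z c where X: "bounded_clinear X" and Z: "bounded_clinear Z"
    and inv: "Z \<circ> X = id" "X \<circ> Z = id"
    and c: "c > 0" "\<And>x y. cinner (X x) (X y) = of_real c * ip x y"
    using equivalent_inner_product_isomorphism[OF eq] by metis
  define V where "V = X \<circ> T \<circ> Z"
  have V: "bounded_clinear V"
    unfolding V_def by (intro bounded_clinear_compose X Z assms)
  have T: "T = Z \<circ> V \<circ> X"
    using inv by (simp add: V_def fun_eq_iff)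
  show "\<exists>V. similar_op T V \<and> m_partial_isometry m V \<and> m_partial_isometry m (cadjoint V)"
    using T0 conjugate_m_partial_isometry_iff[OF ip V Z inv c T] X Z inv T
    unfolding similar_op_def by blast
  \<comment> \<open>The definite description gives the adjoint relation only once existence is
    known; here existence is transported from \<open>cadjoint V\<close>.\<close>
  have adj: "ip (T x) y = ip x (adjoint_wrt ip T y)" for x y
    using adjoint_wrt_conjugate[OF ip V inv c] unfolding T by simp
  show "m_concave_wrt N m T" if "odd m"
    unfolding N by (rule m_concave_if_comp_Delta_I_zero[OF ip adj T0(1) that])
  show "m_concave_wrt N m (adjoint_wrt ip T)" if "odd m"
    unfolding N
    by (rule m_concave_if_comp_Delta_I_zero[OF ip _ T0(2) that]) (metis adj ip_commute[OF ip])
qed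

end
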